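(* Let $\{\mathcal{G}_j : j \in J\}$ be an HS-frame for $\mathbb{H}$ with respect to $\mathbb{K}$ and let $\{\varGamma_j : j \in J\}$ be an alternate dual HS-frame of $\{\mathcal{G}_j : j \in J\}$. Then for every $K \subset J$ and every $f \in \mathbb{H}$, \[ \bigg( \sum_{j \in K^c} \big[ \varGamma_j (f),\mathcal{G}_j (f) \big]_{\tau} \bigg)+ \bigg\Vert \sum_{j \in K} \mathcal{G}_j^* \varGamma_j (f) \bigg\Vert^2 = \overline{\bigg( \sum_{j \in K} \big[ \varGamma_j (f),\mathcal{G}_j (f) \big]_{\tau} \bigg)}+ \bigg\Vert \sum_{j \in K^c} \mathcal{G}_j^* \varGamma_j (f) \bigg\Vert^2 . \]
   Context: $\mathbb{H}$ and $\mathbb{K}$ are complex Hilbert spaces, $J$ is a countable index set, and $K^c = J \setminus K$ for $K \subset J$. $C_2 \subseteq \mathcal{L}(\mathbb{K})$ denotes the Hilbert-Schmidt class of operators on $\mathbb{K}$, a Hilbert space with inner product $[T,S]_\tau = \tau(S^*T)$ ($\tau$ the usual trace) and norm $\Vert T\Vert_2 = [T,T]_\tau^{1/2}$. A family $\{\mathcal{G}_j : j \in J\}$ of bounded linear operators from $\mathbb{H}$ to $C_2 \subseteq \mathcal{L}(\mathbb{K})$ is a Hilbert-Schmidt frame (HS-frame) for $\mathbb{H}$ with respect to $\mathbb{K}$ if there are constants $A,B>0$ such that $A\Vert f\Vert^2 \le \sum_{j\in J}\Vert \mathcal{G}_j(f)\Vert_2^2 \le B\Vert f\Vert^2$ for all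 $f\in\mathbb{H}$. $\mathcal{G}_j^*: C_2 \to \mathbb{H}$ is the adjoint of $\mathcal{G}_j$. An HS-frame $\{\varGamma_j : j\in J\}$ for $\mathbb{H}$ with respect to $\mathbb{K}$ is an alternate dual HS-frame of $\{\mathcal{G}_j : j\in J\}$ if $f=\sum_{j\in J}\mathcal{G}_j^*\varGamma_j f=\sum_{j\in J}\varGamma_j^*\mathcal{G}_j f$ for all $f\in\mathbb{H}$. Series are understood as unconditionally convergent. *)

theory Defs
  imports "HOL-Analysis.Analysis"
begin

text \<open>Complex Hilbert spaces. Inner products are linear in the first and conjugate-linear in the
  second argument, in accordance with \<open>[T, S] = trace (S\<^sup>* T)\<close>. The topology, and hence
  \<^const>\<open>has_sum\<close>, comes from the superclass \<^class>\<open>real_normed_vector\<close>, whose real scalar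
  multiplication and norm are tied to the complex structure by the first and the last axiom.\<close>

class complex_inner = real_normed_vector +
  fixes scaleC :: "complex \<Rightarrow> 'a \<Rightarrow> 'a" (infixr \<open>*\<^sub>C\<close> 75)
    and cinner :: "'a \<Rightarrow> 'a \<Rightarrow> complex"
  assumes scaleR_scaleC: "r *\<^sub>R x = complex_of_real r *\<^sub>C x"
    and scaleC_add_right: "a *\<^sub>C (x + y) = a *\<^sub>C x + a *\<^sub>C y"
    and scaleC_add_left: "(a + b) *\<^sub>C x = a *\<^sub>C x + b *\<^sub>C x"
    and scaleC_scaleC: "a *\<^sub>C b *\<^sub>C x = (a * b) *\<^sub>C x"
    and scaleC_one: "1 *\<^sub>C x = x"
    and cinner_commute: "cinner x y = cnj (cinner y x)"
    and cinner_add_left: "cinner (x + y) z = cinner x z + cinner y z"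
    and cinner_scaleC_left: "cinner (a *\<^sub>C x) y = a * cinner x y"
    and cinner_ge_zero: "0 \<le> Re (cinner x x)"
    and cinner_eq_zero_iff: "cinner x x = 0 \<longleftrightarrow> x = 0"
    and norm_eq_sqrt_cinner: "norm x = sqrt (Re (cinner x x))"

class chilbert_space = complex_inner + complete_space

definition bounded_clinear :: "('a::complex_inner \<Rightarrow> 'b::complex_inner) \<Rightarrow> bool" where
  "bounded_clinear T \<longleftrightarrow> bounded_linear T \<and> (\<forall>c x. T (c *\<^sub>C x) = c *\<^sub>C T x)"

definition cadjoint :: "('a::complex_inner \<Rightarrow> 'b::complex_inner) \<Rightarrow> 'b \<Rightarrow> 'a" where
  "cadjoint T = (THE S. \<forall>x y. cinner (T x) y = cinner x (S y))"

text \<open>An orthonormal basis is a maximal orthonormal set; it need not be countable.\<close>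

definition is_onb :: "'a::complex_inner set \<Rightarrow> bool" where
  "is_onb E \<longleftrightarrow> (\<forall>e\<in>E. norm e = 1) \<and> (\<forall>e\<in>E. \<forall>e'\<in>E. e \<noteq> e' \<longrightarrow> cinner e e' = 0) \<and>
     (\<forall>x. (\<forall>e\<in>E. cinner x e = 0) \<longrightarrow> x = 0)"

definition hilbert_schmidt :: "('k::chilbert_space \<Rightarrow> 'k) set" where
  "hilbert_schmidt = {T. bounded_clinear T \<and>
     (\<exists>E. is_onb E \<and> (\<lambda>e. (norm (T e))\<^sup>2) summable_on E)}"

text \<open>The trace is meaningful for trace class operators, such as products of two
  Hilbert-Schmidt operators; its value then does not depend on the chosen basis.\<close>

definition trace_op :: "('k::chilbert_space \<Rightarrow> 'k) \<Rightarrow> complex" where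
  "trace_op T = (\<Sum>\<^sub>\<infinity>e\<in>(SOME E. is_onb E). cinner (T e) e)"

definition hs_inner :: "('k::chilbert_space \<Rightarrow> 'k) \<Rightarrow> ('k \<Rightarrow> 'k) \<Rightarrow> complex" where
  "hs_inner T S = trace_op (cadjoint S \<circ> T)"

definition hs_norm :: "('k::chilbert_space \<Rightarrow> 'k) \<Rightarrow> real" where
  "hs_norm T = sqrt (Re (hs_inner T T))"

text \<open>Bounded linear operators from \<open>'h\<close> to the Hilbert-Schmidt class; the vector space operations
  of the latter are pointwise and boundedness refers to the Hilbert-Schmidt norm.\<close>

definition bounded_hs_operator :: "('h::chilbert_space \<Rightarrow> 'k::chilbert_space \<Rightarrow> 'k) \<Rightarrow> bool" where
  "bounded_hs_operator G \<longleftrightarrow>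
     (\<forall>f. G f \<in> hilbert_schmidt) \<and>
     (\<forall>f g. G (f + g) = (\<lambda>x. G f x + G g x)) \<and>
     (\<forall>c f. G (c *\<^sub>C f) = (\<lambda>x. c *\<^sub>C G f x)) \<and>
     (\<exists>M. \<forall>f. hs_norm (G f) \<le> M * norm f)"

text \<open>The adjoint, with respect to \<^const>\<open>hs_inner\<close>, of an operator from \<open>'h\<close> to the
  Hilbert-Schmidt class; only its values on \<^const>\<open>hilbert_schmidt\<close> are meaningful.\<close>

definition hs_adjoint ::
    "('h::chilbert_space \<Rightarrow> 'k::chilbert_space \<Rightarrow> 'k) \<Rightarrow> ('k \<Rightarrow> 'k) \<Rightarrow> 'h" where
  "hs_adjoint G T = (THE h. \<forall>f. hs_inner (G f) T = cinner f h)"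

definition hs_frame ::
    "'j set \<Rightarrow> ('j \<Rightarrow> 'h::chilbert_space \<Rightarrow> 'k::chilbert_space \<Rightarrow> 'k) \<Rightarrow> bool" where
  "hs_frame J G \<longleftrightarrow>
     (\<forall>j\<in>J. bounded_hs_operator (G j)) \<and>
     (\<exists>A>0. \<exists>B>0. \<forall>f.
        (\<lambda>j. (hs_norm (G j f))\<^sup>2) summable_on J \<and>
        A * (norm f)\<^sup>2 \<le> (\<Sum>\<^sub>\<infinity>j\<in>J. (hs_norm (G j f))\<^sup>2) \<and>
        (\<Sum>\<^sub>\<infinity>j\<in>J. (hs_norm (G j f))\<^sup>2) \<le> B * (norm f)\<^sup>2)"

definition alternate_dual_hs_frame ::
    "'j set \<Rightarrow> ('j \<Rightarrow> 'h::chilbert_space \<Rightarrow> 'k::chilbert_space \<Rightarrow> 'k) \<Rightarrow>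
     ('j \<Rightarrow> 'h \<Rightarrow> 'k \<Rightarrow> 'k) \<Rightarrow> bool" where
  "alternate_dual_hs_frame J G \<Gamma> \<longleftrightarrow>
     hs_frame J \<Gamma> \<and>
     (\<forall>f. ((\<lambda>j. hs_adjoint (G j) (\<Gamma> j f)) has_sum f) J \<and>
          ((\<lambda>j. hs_adjoint (\<Gamma> j) (G j f)) has_sum f) J)"

end

theory Submission imports Defs begin

text \<open>Put \<open>u = \<Sum>j\<in>K. G\<^sub>j\<^sup>* (\<Gamma>\<^sub>j f)\<close> and \<open>v = \<Sum>j\<in>J - K. G\<^sub>j\<^sup>* (\<Gamma>\<^sub>j f)\<close>, so that \<open>f = u + v\<close>. Since
  \<open>[\<Gamma>\<^sub>j f, G\<^sub>j f] = \<langle>G\<^sub>j\<^sup>* (\<Gamma>\<^sub>j f), f\<rangle>\<close>, the claim is \<open>\<langle>v, f\<rangle> + \<parallel>u\<parallel>\<^sup>2 = \<langle>f, u\<rangle> + \<parallel>v\<parallel>\<^sup>2\<close>, where both sides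
  equal \<open>\<parallel>u\<parallel>\<^sup>2 + \<langle>v, u\<rangle> + \<parallel>v\<parallel>\<^sup>2\<close>. The existence of the adjoints rests on Riesz representation and
  on the independence of square summability of \<open>\<parallel>T e\<parallel>\<close> from the orthonormal basis.\<close>

text \<open>The passage to subfamilies of an unconditionally convergent series,
  \<open>summable_on_subset_banach\<close>, is stated for this class.\<close>

instance chilbert_space \<subseteq> banach ..

section \<open>Algebra of the complex inner product\<close>

lemma cinner_add_right: "cinner x (y + z) = cinner x y + cinner x z"
  by (metis cinner_add_left cinner_commute complex_cnj_add)

lemma cinner_scaleC_right: "cinner x (a *\<^sub>C y) = cnj a * cinner x y"
  by (metis cinner_scaleC_left cinner_commute complex_cnj_mult)

lemma cinner_scaleR_left: "cinner (r *\<^sub>R x) y = complex_of_real r * cinner x y"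
  by (simp add: scaleR_scaleC cinner_scaleC_left)

lemma cinner_scaleR_right: "cinner x (r *\<^sub>R y) = complex_of_real r * cinner x y"
  by (simp add: scaleR_scaleC cinner_scaleC_right)

lemma cinner_zero_left [simp]: "cinner 0 x = 0"
  using cinner_add_left[of 0 0 x] by simp

lemma cinner_zero_right [simp]: "cinner x 0 = 0"
  using cinner_add_right[of x 0 0] by simp

lemma cinner_diff_left: "cinner (x - y) z = cinner x z - cinner y z"
  using cinner_add_left[of "x - y" y z] by simp

lemma cinner_diff_right: "cinner x (y - z) = cinner x y - cinner x z"
  using cinner_add_right[of x "y - z" z] by simp

lemma cinner_sum_left: "cinner (\<Sum>i\<in>A. f i) y = (\<Sum>i\<in>A. cinner (f i) y)"
  by (induction A rule: infinite_finite_induct) (simp_all add: cinner_add_left)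

lemma cinner_sum_right: "cinner x (\<Sum>i\<in>A. f i) = (\<Sum>i\<in>A. cinner x (f i))"
  by (induction A rule: infinite_finite_induct) (simp_all add: cinner_add_right)

lemma power2_norm_eq_Re_cinner: "(norm x)\<^sup>2 = Re (cinner x x)"
  by (simp add: norm_eq_sqrt_cinner cinner_ge_zero)

lemma cinner_self: "cinner x x = complex_of_real ((norm x)\<^sup>2)"
proof -
  have "Im (cinner x x) = 0"
    using arg_cong[OF cinner_commute[of x x], of Im] by simp
  then show ?thesis
    by (simp add: complex_eq_iff power2_norm_eq_Re_cinner)
qed

lemma Re_cinner_commute: "Re (cinner x y) = Re (cinner y x)"
  by (subst cinner_commute) simp

lemma norm_cinner_commute: "norm (cinner x y) = norm (cinner y x)"
  by (subst cinner_commute) simp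

lemma power2_norm_add:
  fixes x y :: "'a::complex_inner"
  shows "(norm (x + y))\<^sup>2 = (norm x)\<^sup>2 + 2 * Re (cinner x y) + (norm y)\<^sup>2"
  by (simp add: power2_norm_eq_Re_cinner cinner_add_left cinner_add_right Re_cinner_commute[of y x])

lemma power2_norm_diff:
  fixes x y :: "'a::complex_inner"
  shows "(norm (x - y))\<^sup>2 = (norm x)\<^sup>2 - 2 * Re (cinner x y) + (norm y)\<^sup>2"
  by (simp add: power2_norm_eq_Re_cinner cinner_diff_left cinner_diff_right Re_cinner_commute[of y x])

text \<open>Tested with \<open>x = y - z\<close>. This gives the uniqueness of Riesz vectors and of
  both kinds of adjoint.\<close>

lemma cinner_right_eqI:
  assumes "\<And>x. cinner x y = cinner x z"
  shows "y = z"
  using assms[of "y - z"] cinner_diff_right[of "y - z" y z] by (simp add: cinner_eq_zero_iff)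

section \<open>Orthonormal sets, Bessel and Cauchy-Schwarz inequalities\<close>

definition is_orthonormal :: "'a::complex_inner set \<Rightarrow> bool" where
  "is_orthonormal E \<longleftrightarrow> (\<forall>e\<in>E. \<forall>e'\<in>E. cinner e e' = (if e = e' then 1 else 0))"

lemma is_onb_imp_orthonormal: "is_onb E \<Longrightarrow> is_orthonormal E"
  by (auto simp: is_onb_def is_orthonormal_def cinner_self)

text \<open>The vector \<open>y\<close> is the orthogonal projection of \<open>x\<close> onto the
  span of \<open>F\<close>. Both \<open>cinner x y\<close> and \<open>(norm y)\<^sup>2\<close> equal
  the coefficient sum \<open>s\<close>, so \<open>(norm x)\<^sup>2 - s\<close> is the square of
  \<open>norm (x - y)\<close>.\<close>

lemma Bessel_finite:
  assumes "is_orthonormal E" "F \<subseteq> E" "finite F"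
  shows "(\<Sum>e\<in>F. (norm (cinner x e))\<^sup>2) \<le> (norm x)\<^sup>2"
proof -
  define y where "y = (\<Sum>e\<in>F. cinner x e *\<^sub>C e)"
  define s where "s = (\<Sum>e\<in>F. (norm (cinner x e))\<^sup>2)"
  have xy: "cinner x y = complex_of_real s"
    by (simp add: y_def s_def cinner_sum_right cinner_scaleC_right complex_norm_square
        mult.commute del: of_real_power)
  have ey: "cinner e y = cnj (cinner x e)" if "e \<in> F" for e
  proof -
    have "cinner e y = (\<Sum>e'\<in>F. cnj (cinner x e') * cinner e e')"
      by (simp add: y_def cinner_sum_right cinner_scaleC_right)
    also have "\<dots> = (\<Sum>e'\<in>F. if e = e' then cnj (cinner x e') else 0)"
      using assms that by (intro sum.cong) (auto simp: is_orthonormal_def subset_iff)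
    finally show ?thesis using assms that by simp
  qed
  have "cinner y y = (\<Sum>e\<in>F. cinner x e * cinner e y)"
    by (subst (1) y_def) (simp add: cinner_sum_left cinner_scaleC_left)
  also have "\<dots> = complex_of_real s"
    by (simp add: s_def ey complex_norm_square del: of_real_power)
  finally have "(norm y)\<^sup>2 = s"
    by (simp add: power2_norm_eq_Re_cinner)
  then have "(norm (x - y))\<^sup>2 = (norm x)\<^sup>2 - s"
    by (simp add: power2_norm_diff xy)
  then show ?thesis
    using zero_le_power2[of "norm (x - y)"] by (simp add: s_def)
qed

text \<open>Bessel's inequality for a single vector, the normalised \<open>y\<close>.\<close>

lemma norm_cinner_le: "norm (cinner x y) \<le> norm x * norm y"
proof (cases "y = 0")
  case False
  define e where "e = (1 / norm y) *\<^sub>R y"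
  have "is_orthonormal {e}"
    using False by (simp add: is_orthonormal_def cinner_self e_def)
  from Bessel_finite[OF this, of "{e}" x] have "norm (cinner x e) \<le> norm x"
    by (simp add: power2_le_iff_abs_le)
  then show ?thesis
    using False by (simp add: e_def cinner_scaleR_right norm_mult norm_divide field_simps)
qed simp

section \<open>Bounded functionals, Riesz representation and adjoints\<close>

lemma bounded_linear_cinner_left: "bounded_linear (\<lambda>x. cinner x y)"
  by (rule bounded_linear_intro[where K = "norm y"])
    (simp_all add: cinner_add_left cinner_scaleR_left norm_cinner_le scaleR_conv_of_real)

text \<open>The representing vector minimises \<open>\<parallel>x\<parallel>\<^sup>2 - 2 Re (\<phi> x)\<close>; by the parallelogram law every
  minimising sequence is Cauchy.\<close>

theorem Riesz_representation:
  fixes \<phi> :: "'a::chilbert_space \<Rightarrow> complex"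
  assumes lin: "bounded_linear \<phi>" and hom: "\<And>c x. \<phi> (c *\<^sub>C x) = c * \<phi> x"
  shows "\<exists>!h. \<forall>x. \<phi> x = cinner x h"
proof -
  interpret \<phi>: bounded_linear \<phi> by (rule lin)
  define Q where "Q x = (norm x)\<^sup>2 - 2 * Re (\<phi> x)" for x
  obtain C where C: "\<And>x. norm (\<phi> x) \<le> norm x * C"
    using \<phi>.bounded by blast
  \<comment> \<open>Completing the square in \<open>norm x\<close> bounds \<open>Q\<close> below, so
    its infimum \<open>m\<close> is finite.\<close>
  have "- C\<^sup>2 \<le> Q x" for x
  proof -
    have "Re (\<phi> x) \<le> norm x * C"
      using C[of x] complex_Re_le_cmod[of "\<phi> x"] by linarith
    moreover have "0 \<le> (norm x - C)\<^sup>2" by simp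
    ultimately show ?thesis
      by (simp add: Q_def power2_diff)
  qed
  then have bdd: "bdd_below (range Q)"
    by (auto simp: bdd_below_def)
  define m where "m = Inf (range Q)"
  have m_le: "m \<le> Q x" for x
    unfolding m_def by (rule cInf_lower[OF rangeI bdd])
  have "\<exists>x. Q x < m + 1 / real (Suc n)" for n
    using cInf_lessD[of "range Q" "m + 1 / real (Suc n)"] by (auto simp: m_def)
  then obtain X where X: "\<And>n. Q (X n) < m + 1 / real (Suc n)"
    by metis
  \<comment> \<open>\<open>Q\<close> at the midpoint of \<open>x\<close> and \<open>y\<close> is at
    least \<open>m\<close>.\<close>
  have par: "(norm (x - y))\<^sup>2 \<le> 2 * (Q x - m) + 2 * (Q y - m)" for x y
  proof -
    have "4 * Q ((1/2) *\<^sub>R (x + y)) = (norm (x + y))\<^sup>2 - 4 * Re (\<phi> x) - 4 * Re (\<phi> y)"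
      by (simp add: Q_def \<phi>.scaleR \<phi>.add power_divide ring_distribs del: scaleR_add_right)
    moreover have "(norm (x - y))\<^sup>2 + (norm (x + y))\<^sup>2 = 2 * (norm x)\<^sup>2 + 2 * (norm y)\<^sup>2"
      by (simp add: power2_norm_add power2_norm_diff)
    ultimately show ?thesis
      using m_le[of "(1/2) *\<^sub>R (x + y)"] unfolding Q_def[of x] Q_def[of y] by argo
  qed
  have "Cauchy X"
  proof (rule metric_CauchyI)
    fix e :: real assume "0 < e"
    \<comment> \<open>Gaps below \<open>e\<^sup>2 / 4\<close> at both indices make the bound in
      \<open>par\<close> smaller than \<open>e\<^sup>2\<close>.\<close>
    then obtain N where N: "1 / real (Suc N) < e\<^sup>2 / 4"
      using reals_Archimedean[of "e\<^sup>2 / 4"] by (auto simp: inverse_eq_divide)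
    have "dist (X i) (X k) < e" if "N \<le> i" "N \<le> k" for i k
    proof -
      have "Q (X n) - m < e\<^sup>2 / 4" if "N \<le> n" for n
        using X[of n] N frac_le[of 1 1 "real (Suc N)" "real (Suc n)"] that by auto
      from this[OF that(1)] this[OF that(2)] have "(norm (X i - X k))\<^sup>2 < e\<^sup>2"
        using par[of "X i" "X k"] by argo
      then show ?thesis
        using \<open>0 < e\<close> by (simp add: dist_norm power_less_imp_less_base)
    qed
    then show "\<exists>N. \<forall>i\<ge>N. \<forall>k\<ge>N. dist (X i) (X k) < e" by blast
  qed
  then obtain h where h: "X \<longlonglongrightarrow> h"
    using Cauchy_convergent_iff convergent_def by blast
  have "(\<lambda>n. Q (X n)) \<longlonglongrightarrow> Q h"
    unfolding Q_def by (intro tendsto_intros \<phi>.tendsto h)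
  moreover have "(\<lambda>n. m + 1 / real (Suc n)) \<longlonglongrightarrow> m"
    using tendsto_add[OF tendsto_const LIMSEQ_inverse_real_of_nat, of m]
    by (simp add: inverse_eq_divide)
  ultimately have "Q h \<le> m"
    by (rule LIMSEQ_le) (use X less_imp_le in blast)
  have Re_eq: "Re (\<phi> x) = Re (cinner x h)" for x
  proof -
    define d where "d = Re (cinner x h) - Re (\<phi> x)"
    \<comment> \<open>Minimality of \<open>h\<close> along the line
      \<open>h + t *\<^sub>R x\<close>; the linear coefficient \<open>2 * d\<close> has to
      vanish.\<close>
    have quad: "0 \<le> t\<^sup>2 * (norm x)\<^sup>2 + 2 * t * d" for t
    proof -
      have "Q (h + t *\<^sub>R x) = Q h + t\<^sup>2 * (norm x)\<^sup>2 + 2 * t * d"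
        by (simp add: Q_def power2_norm_add \<phi>.add \<phi>.scaleR d_def power_mult_distrib
            cinner_scaleR_right Re_cinner_commute[of h x] algebra_simps)
      then show ?thesis
        using m_le[of "h + t *\<^sub>R x"] \<open>Q h \<le> m\<close> by linarith
    qed
    \<comment> \<open>Adding 1 keeps \<open>k\<close> positive even for \<open>x = 0\<close>. At
      \<open>t = - d / k\<close> the quadratic is negative unless \<open>d = 0\<close>.\<close>
    define k where "k = (norm x)\<^sup>2 + 1"
    have "k > 0" by (simp add: k_def add_nonneg_pos)
    have "0 \<le> (d / k)\<^sup>2 * (k - 1) - 2 * (d / k) * d"
      using quad[of "- d / k"] by (simp add: k_def)
    also have "\<dots> = - (d\<^sup>2 * (k + 1) / k\<^sup>2)"
      using \<open>k > 0\<close> by (simp add: field_simps power2_eq_square)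
    finally have "d\<^sup>2 * (k + 1) / k\<^sup>2 \<le> 0" by simp
    then have "d = 0"
      using \<open>k > 0\<close> by (auto simp: divide_le_0_iff mult_le_0_iff)
    then show ?thesis by (simp add: d_def)
  qed
  \<comment> \<open>Since both sides are complex linear, the real parts at
    \<open>\<i> *\<^sub>C x\<close> recover the imaginary parts at \<open>x\<close>.\<close>
  have "\<phi> x = cinner x h" for x
    using Re_eq[of x] Re_eq[of "\<i> *\<^sub>C x"] by (simp add: hom cinner_scaleC_left complex_eq_iff)
  then show ?thesis
    using cinner_right_eqI by metis
qed

text \<open>Riesz vectors of \<open>cinner (T x) y\<close>, one for each \<open>y\<close>, form the
  unique function described by the \<open>THE\<close> in \<open>cadjoint\<close>.\<close>

lemma cadjoint_works:
  fixes T :: "'a::chilbert_space \<Rightarrow> 'b::chilbert_space"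
  assumes "bounded_clinear T"
  shows "cinner (T x) y = cinner x (cadjoint T y)"
proof -
  have bl: "bounded_linear T" and hom: "\<And>c x. T (c *\<^sub>C x) = c *\<^sub>C T x"
    using assms by (auto simp: bounded_clinear_def)
  have "\<exists>!h. \<forall>x. cinner (T x) y = cinner x h" for y
    by (rule Riesz_representation[OF bounded_linear_compose[OF bounded_linear_cinner_left bl]])
      (simp add: hom cinner_scaleC_left)
  then obtain S where S: "\<forall>x y. cinner (T x) y = cinner x (S y)"
    by metis
  have "cadjoint T = S"
    unfolding cadjoint_def
  proof (rule the_equality)
    fix S' assume "\<forall>x y. cinner (T x) y = cinner x (S' y)"
    then show "S' = S"
      using S by (intro ext cinner_right_eqI) metis
  qed (rule S)
  then show ?thesis using S by simp
qed

section \<open>Infinite sums: Cauchy-Schwarz, Bessel and Parseval\<close>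

lemma Cauchy_Schwarz_infsum:
  fixes a b :: "'i \<Rightarrow> real"
  assumes "\<And>i. i \<in> A \<Longrightarrow> 0 \<le> a i" "\<And>i. i \<in> A \<Longrightarrow> 0 \<le> b i"
    and a: "(\<lambda>i. (a i)\<^sup>2) summable_on A" and b: "(\<lambda>i. (b i)\<^sup>2) summable_on A"
  shows "(\<lambda>i. a i * b i) summable_on A"
    and "(\<Sum>\<^sub>\<infinity>i\<in>A. a i * b i) \<le> sqrt (\<Sum>\<^sub>\<infinity>i\<in>A. (a i)\<^sup>2) * sqrt (\<Sum>\<^sub>\<infinity>i\<in>A. (b i)\<^sup>2)"
proof -
  \<comment> \<open>The bound does not depend on \<open>F\<close>; as the terms are nonnegative, it
    yields both convergence and the estimate.\<close>
  have fin: "(\<Sum>i\<in>F. a i * b i) \<le> sqrt (\<Sum>\<^sub>\<infinity>i\<in>A. (a i)\<^sup>2) * sqrt (\<Sum>\<^sub>\<infinity>i\<in>A. (b i)\<^sup>2)"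
    if "finite F" "F \<subseteq> A" for F
  proof -
    have "(\<Sum>i\<in>F. a i * b i) \<le> (\<Sum>i\<in>F. \<bar>a i\<bar> * \<bar>b i\<bar>)"
      by (intro sum_mono) (simp flip: abs_mult)
    also have "\<dots> \<le> L2_set a F * L2_set b F"
      by (rule L2_set_mult_ineq)
    also have "\<dots> \<le> sqrt (\<Sum>\<^sub>\<infinity>i\<in>A. (a i)\<^sup>2) * sqrt (\<Sum>\<^sub>\<infinity>i\<in>A. (b i)\<^sup>2)"
      unfolding L2_set_def using that a b
      by (intro mult_mono real_sqrt_le_mono finite_sum_le_infsum)
        (auto intro!: infsum_nonneg sum_nonneg)
    finally show ?thesis .
  qed
  show s: "(\<lambda>i. a i * b i) summable_on A"
    using assms fin by (intro nonneg_bdd_above_summable_on bdd_aboveI2) auto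
  show "(\<Sum>\<^sub>\<infinity>i\<in>A. a i * b i) \<le> sqrt (\<Sum>\<^sub>\<infinity>i\<in>A. (a i)\<^sup>2) * sqrt (\<Sum>\<^sub>\<infinity>i\<in>A. (b i)\<^sup>2)"
    using fin by (intro infsum_le_finite_sums s) auto
qed

lemma Bessel:
  assumes "is_orthonormal E"
  shows "(\<lambda>e. (norm (cinner x e))\<^sup>2) summable_on E"
    and "(\<Sum>\<^sub>\<infinity>e\<in>E. (norm (cinner x e))\<^sup>2) \<le> (norm x)\<^sup>2"
proof -
  show s: "(\<lambda>e. (norm (cinner x e))\<^sup>2) summable_on E"
    using Bessel_finite[OF assms] by (intro nonneg_bdd_above_summable_on bdd_aboveI2) auto
  show "(\<Sum>\<^sub>\<infinity>e\<in>E. (norm (cinner x e))\<^sup>2) \<le> (norm x)\<^sup>2"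
    using Bessel_finite[OF assms] by (intro infsum_le_finite_sums s) auto
qed

text \<open>By maximality of \<open>E\<close>, \<open>x\<close> is the Riesz vector of the bounded functional
  \<open>y \<mapsto> \<Sum>e. \<langle>y, e\<rangle> \<langle>e, x\<rangle>\<close>.\<close>

lemma Parseval:
  fixes x :: "'a::chilbert_space"
  assumes "is_onb E"
  shows "((\<lambda>e. (norm (cinner x e))\<^sup>2) has_sum (norm x)\<^sup>2) E"
proof -
  have on: "is_orthonormal E"
    by (rule is_onb_imp_orthonormal[OF assms])
  define \<phi> where "\<phi> y = (\<Sum>\<^sub>\<infinity>e\<in>E. cinner y e * cinner e x)" for y
  \<comment> \<open>This majorant gives absolute convergence of the series for
    \<open>\<phi> y\<close> and the operator bound \<open>norm x\<close>.\<close>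
  have CS: "(\<lambda>e. norm (cinner y e) * norm (cinner x e)) summable_on E"
    "(\<Sum>\<^sub>\<infinity>e\<in>E. norm (cinner y e) * norm (cinner x e)) \<le> norm y * norm x" for y
  proof -
    show "(\<lambda>e. norm (cinner y e) * norm (cinner x e)) summable_on E"
      by (rule Cauchy_Schwarz_infsum) (simp_all add: Bessel(1)[OF on])
    have "(\<Sum>\<^sub>\<infinity>e\<in>E. norm (cinner y e) * norm (cinner x e))
        \<le> sqrt (\<Sum>\<^sub>\<infinity>e\<in>E. (norm (cinner y e))\<^sup>2) * sqrt (\<Sum>\<^sub>\<infinity>e\<in>E. (norm (cinner x e))\<^sup>2)"
      by (rule Cauchy_Schwarz_infsum) (simp_all add: Bessel(1)[OF on])
    also have "\<dots> \<le> norm y * norm x"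
      by (intro mult_mono real_le_lsqrt Bessel(2)[OF on]) (auto intro!: infsum_nonneg)
    finally show "(\<Sum>\<^sub>\<infinity>e\<in>E. norm (cinner y e) * norm (cinner x e)) \<le> norm y * norm x" .
  qed
  have abs: "(\<lambda>e. norm (cinner y e * cinner e x)) summable_on E" for y
    using CS(1)[of y] by (simp add: norm_mult norm_cinner_commute[of _ x])
  note summable = abs_summable_summable[OF abs]
  have hom: "\<phi> (c *\<^sub>C y) = c * \<phi> y" for c y
    by (simp add: \<phi>_def cinner_scaleC_left mult.assoc infsum_cmult_right')
  have "bounded_linear \<phi>"
  proof (rule bounded_linear_intro[where K = "norm x"])
    show "\<phi> (y + z) = \<phi> y + \<phi> z" for y z
      by (simp add: \<phi>_def cinner_add_left ring_distribs infsum_add[OF summable summable])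
    show "\<phi> (r *\<^sub>R y) = r *\<^sub>R \<phi> y" for r y
      by (simp add: scaleR_scaleC hom scaleR_conv_of_real)
    show "norm (\<phi> y) \<le> norm y * norm x" for y
      using norm_infsum_bound[OF abs[of y]] CS(2)[of y]
      by (simp add: \<phi>_def norm_mult norm_cinner_commute[of _ x])
  qed
  from Riesz_representation[OF this hom] obtain h where h: "\<And>y. \<phi> y = cinner y h"
    by blast
  have \<phi>_basis: "\<phi> e = cinner e x" if "e \<in> E" for e
  proof -
    have "\<phi> e = (\<Sum>\<^sub>\<infinity>e'\<in>{e}. cinner e e' * cinner e' x)"
      unfolding \<phi>_def using on that by (intro infsum_cong_neutral) (auto simp: is_orthonormal_def)
    then show ?thesis
      using on that by (simp add: is_orthonormal_def)
  qed
  \<comment> \<open>On \<open>E\<close> the series for \<open>\<phi>\<close> collapses to one term,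
    so \<open>h\<close> and \<open>x\<close> have the same coefficients and maximality of
    \<open>E\<close> gives \<open>h = x\<close>.\<close>
  have "cinner (h - x) e = 0" if "e \<in> E" for e
  proof -
    have "cinner e (h - x) = 0"
      using h[of e] \<phi>_basis[OF that] by (simp add: cinner_diff_right)
    then show ?thesis by (subst cinner_commute) simp
  qed
  then have "h = x"
    using assms unfolding is_onb_def by (metis eq_iff_diff_eq_0)
  then have "((\<lambda>e. cinner x e * cinner e x) has_sum cinner x x) E"
    using has_sum_infsum[OF summable[of x]] h[of x] by (simp add: \<phi>_def)
  then have "((\<lambda>e. Re (cinner x e * cinner e x)) has_sum Re (cinner x x)) E"
    by (rule has_sum_Re)
  moreover have "Re (cinner x e * cinner e x) = (norm (cinner x e))\<^sup>2" for e
    by (subst (2) cinner_commute) (simp flip: complex_norm_square)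
  ultimately show ?thesis
    by (simp add: power2_norm_eq_Re_cinner)
qed

section \<open>Independence of square summability from the basis\<close>

lemma has_sum_sum:
  fixes f :: "'i \<Rightarrow> 'a \<Rightarrow> 'b::topological_comm_monoid_add"
  assumes "\<And>i. i \<in> I \<Longrightarrow> (f i has_sum s i) A"
  shows "((\<lambda>x. \<Sum>i\<in>I. f i x) has_sum (\<Sum>i\<in>I. s i)) A"
  using assms by (induction I rule: infinite_finite_induct) (simp_all add: has_sum_add has_sum_0)

text \<open>Parseval over \<open>E\<close> expands each \<open>(norm (B g))\<^sup>2\<close>. After
  exchanging the sum with a finite one over \<open>F'\<close>, Bessel bounds the inner sum by
  \<open>(norm (A e))\<^sup>2\<close>.\<close>

lemma square_summable_adjoint:
  fixes A :: "'a::chilbert_space \<Rightarrow> 'b::chilbert_space"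
  assumes adj: "\<And>x y. cinner (A x) y = cinner x (B y)"
    and E: "is_onb E" and F: "is_orthonormal F"
    and A: "(\<lambda>e. (norm (A e))\<^sup>2) summable_on E"
  shows "(\<lambda>e. (norm (B e))\<^sup>2) summable_on F"
proof (rule nonneg_bdd_above_summable_on)
  have "(\<Sum>g\<in>F'. (norm (B g))\<^sup>2) \<le> (\<Sum>\<^sub>\<infinity>e\<in>E. (norm (A e))\<^sup>2)"
    if F': "F' \<subseteq> F" "finite F'" for F'
  proof -
    have "((\<lambda>e. \<Sum>g\<in>F'. (norm (cinner (A e) g))\<^sup>2) has_sum (\<Sum>g\<in>F'. (norm (B g))\<^sup>2)) E"
      using Parseval[OF E, of "B _"]
      by (intro has_sum_sum) (simp add: adj norm_cinner_commute[of _ "B _"])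
    moreover have "((\<lambda>e. (norm (A e))\<^sup>2) has_sum (\<Sum>\<^sub>\<infinity>e\<in>E. (norm (A e))\<^sup>2)) E"
      using A by simp
    ultimately show ?thesis
      by (rule has_sum_mono) (use Bessel_finite[OF F F'] in blast)
  qed
  then show "bdd_above (sum (\<lambda>e. (norm (B e))\<^sup>2) ` {F'. F' \<subseteq> F \<and> finite F'})"
    by (intro bdd_aboveI2) auto
qed simp

text \<open>The definition provides only some basis \<open>E\<close>. Going to the adjoint and back
  moves summability from \<open>T\<close> on \<open>E\<close> to \<open>cadjoint T\<close> on
  \<open>F\<close>, then to \<open>T\<close> on \<open>F\<close>.\<close>

lemma hilbert_schmidt_square_summable:
  assumes "T \<in> hilbert_schmidt" "is_onb F"
  shows "(\<lambda>e. (norm (T e))\<^sup>2) summable_on F"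
proof -
  obtain E where E: "is_onb E" "(\<lambda>e. (norm (T e))\<^sup>2) summable_on E" and T: "bounded_clinear T"
    using assms(1) by (auto simp: hilbert_schmidt_def)
  note adj = cadjoint_works[OF T]
  have adj': "cinner (cadjoint T x) y = cinner x (T y)" for x y
    by (metis adj cinner_commute)
  show ?thesis
    by (rule square_summable_adjoint[OF adj' assms(2) is_onb_imp_orthonormal[OF assms(2)]
          square_summable_adjoint[OF adj E(1) is_onb_imp_orthonormal[OF assms(2)] E(2)]])
qed

section \<open>Hilbert-Schmidt inner product and adjoints into \<open>'h\<close>\<close>

definition trace_basis :: "'k::chilbert_space set" where
  "trace_basis = (SOME E. is_onb E)"

text \<open>The basis witnessing \<open>T \<in> hilbert_schmidt\<close> shows that the choice by
  \<open>SOME\<close> is not void.\<close>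

lemma is_onb_trace_basis:
  assumes "(T :: 'k::chilbert_space \<Rightarrow> 'k) \<in> hilbert_schmidt"
  shows "is_onb (trace_basis :: 'k set)"
  unfolding trace_basis_def by (rule someI_ex) (use assms in \<open>auto simp: hilbert_schmidt_def\<close>)

text \<open>Moving \<open>cadjoint S\<close> across the inner product turns the trace into a series
  that can be handled termwise.\<close>

lemma hs_inner_eq:
  fixes T S :: "'k::chilbert_space \<Rightarrow> 'k"
  assumes "S \<in> hilbert_schmidt"
  shows "hs_inner T S = (\<Sum>\<^sub>\<infinity>e\<in>trace_basis. cinner (T e) (S e))"
proof -
  have "cinner ((cadjoint S \<circ> T) e) e = cinner (T e) (S e)" for e
    using assms cadjoint_works[of S e "T e"] unfolding hilbert_schmidt_def comp_def
    by (metis (no_types, lifting) cinner_commute mem_Collect_eq)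
  then show ?thesis
    by (simp add: hs_inner_def trace_op_def trace_basis_def)
qed

lemma hs_inner_commute:
  assumes "T \<in> hilbert_schmidt" "S \<in> hilbert_schmidt"
  shows "hs_inner S T = cnj (hs_inner T S)"
  unfolding hs_inner_eq[OF assms(1)] hs_inner_eq[OF assms(2)] infsum_cnj[symmetric]
  by (rule infsum_cong) (rule cinner_commute)

lemma hs_norm_eq:
  assumes "T \<in> hilbert_schmidt"
  shows "hs_norm T = sqrt (\<Sum>\<^sub>\<infinity>e\<in>trace_basis. (norm (T e))\<^sup>2)"
proof -
  have "((\<lambda>e. complex_of_real ((norm (T e))\<^sup>2)) has_sum
      complex_of_real (\<Sum>\<^sub>\<infinity>e\<in>trace_basis. (norm (T e))\<^sup>2)) trace_basis"
    by (intro has_sum_of_real has_sum_infsum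
        hilbert_schmidt_square_summable[OF assms is_onb_trace_basis[OF assms]])
  then have "hs_inner T T = complex_of_real (\<Sum>\<^sub>\<infinity>e\<in>trace_basis. (norm (T e))\<^sup>2)"
    by (simp add: hs_inner_eq[OF assms] cinner_self infsumI)
  then show ?thesis
    by (simp add: hs_norm_def)
qed

text \<open>Cauchy-Schwarz twice: for the vectors \<open>T e\<close> and \<open>S e\<close>, then
  for their norms over the basis.\<close>

lemma hs_inner_Cauchy_Schwarz:
  assumes "T \<in> hilbert_schmidt" "S \<in> hilbert_schmidt"
  shows "(\<lambda>e. norm (cinner (T e) (S e))) summable_on trace_basis"
    and "norm (hs_inner T S) \<le> hs_norm T * hs_norm S"
proof -
  note sq = hilbert_schmidt_square_summable[OF _ is_onb_trace_basis[OF assms(1)]]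
  have s: "(\<lambda>e. norm (T e) * norm (S e)) summable_on trace_basis"
    by (rule Cauchy_Schwarz_infsum) (simp_all add: sq assms)
  show abs: "(\<lambda>e. norm (cinner (T e) (S e))) summable_on trace_basis"
    by (rule summable_on_comparison_test[OF s]) (simp_all add: norm_cinner_le)
  have "norm (hs_inner T S) \<le> (\<Sum>\<^sub>\<infinity>e\<in>trace_basis. norm (cinner (T e) (S e)))"
    unfolding hs_inner_eq[OF assms(2)] by (rule norm_infsum_bound[OF abs])
  also have "\<dots> \<le> (\<Sum>\<^sub>\<infinity>e\<in>trace_basis. norm (T e) * norm (S e))"
    by (rule infsum_mono[OF abs s]) (rule norm_cinner_le)
  also have "\<dots> \<le> hs_norm T * hs_norm S"
    unfolding hs_norm_eq[OF assms(1)] hs_norm_eq[OF assms(2)]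
    by (rule Cauchy_Schwarz_infsum) (simp_all add: sq assms)
  finally show "norm (hs_inner T S) \<le> hs_norm T * hs_norm S" .
qed

text \<open>Absolute convergence makes \<open>hs_inner (G f) T\<close> additive in \<open>f\<close>,
  and Cauchy-Schwarz bounds it by \<open>M * hs_norm T\<close>; its Riesz vector in
  \<open>'h\<close> is the adjoint value.\<close>

lemma hs_adjoint_works:
  fixes G :: "'h::chilbert_space \<Rightarrow> 'k::chilbert_space \<Rightarrow> 'k"
  assumes G: "bounded_hs_operator G" and T: "T \<in> hilbert_schmidt"
  shows "hs_inner (G f) T = cinner f (hs_adjoint G T)"
proof -
  have hs: "G f \<in> hilbert_schmidt" for f
    using G by (simp add: bounded_hs_operator_def)
  obtain M where M: "\<And>f. hs_norm (G f) \<le> M * norm f"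
    using G by (auto simp: bounded_hs_operator_def)
  note summable = abs_summable_summable[OF hs_inner_Cauchy_Schwarz(1)[OF hs T]]
  have hom: "hs_inner (G (c *\<^sub>C f)) T = c * hs_inner (G f) T" for c f
    using G by (simp add: bounded_hs_operator_def hs_inner_eq[OF T] cinner_scaleC_left
        infsum_cmult_right')
  have "bounded_linear (\<lambda>f. hs_inner (G f) T)"
  proof (rule bounded_linear_intro[where K = "M * hs_norm T"])
    show "hs_inner (G (f + g)) T = hs_inner (G f) T + hs_inner (G g) T" for f g
      using G by (simp add: bounded_hs_operator_def hs_inner_eq[OF T] cinner_add_left
          infsum_add[OF summable summable])
    show "hs_inner (G (r *\<^sub>R f)) T = r *\<^sub>R hs_inner (G f) T" for r f
      by (simp add: scaleR_scaleC hom scaleR_conv_of_real)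
    show "norm (hs_inner (G f) T) \<le> norm f * (M * hs_norm T)" for f
    proof -
      have "0 \<le> hs_norm T"
        by (simp add: hs_norm_eq[OF T] infsum_nonneg)
      then have "hs_norm (G f) * hs_norm T \<le> M * norm f * hs_norm T"
        by (intro mult_right_mono M)
      then show ?thesis
        using hs_inner_Cauchy_Schwarz(2)[OF hs[of f] T] by (simp add: mult_ac)
    qed
  qed
  from Riesz_representation[OF this hom] obtain h where h: "\<forall>f. hs_inner (G f) T = cinner f h"
    by blast
  have "hs_adjoint G T = h"
    unfolding hs_adjoint_def
  proof (rule the_equality)
    fix h' assume "\<forall>f. hs_inner (G f) T = cinner f h'"
    then show "h' = h"
      using h by (intro cinner_right_eqI) simp
  qed (rule h)
  then show ?thesis using h by simp
qed

section \<open>Splitting the reconstruction of \<open>f\<close> along \<open>K\<close>\<close>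

theorem theorem3p10:
  fixes J K :: "'j set"
    and G \<Gamma> :: "'j \<Rightarrow> 'h::chilbert_space \<Rightarrow> 'k::chilbert_space \<Rightarrow> 'k"
    and f :: 'h
  assumes "countable J"
    and "hs_frame J G"
    and "alternate_dual_hs_frame J G \<Gamma>"
    and "K \<subseteq> J"
  shows "(\<lambda>j. hs_inner (\<Gamma> j f) (G j f)) summable_on K \<and>
    (\<lambda>j. hs_inner (\<Gamma> j f) (G j f)) summable_on (J - K) \<and>
    (\<lambda>j. hs_adjoint (G j) (\<Gamma> j f)) summable_on K \<and>
    (\<lambda>j. hs_adjoint (G j) (\<Gamma> j f)) summable_on (J - K) \<and>
    (\<Sum>\<^sub>\<infinity>j\<in>J - K. hs_inner (\<Gamma> j f) (G j f)) +
      complex_of_real ((norm (\<Sum>\<^sub>\<infinity>j\<in>K. hs_adjoint (G j) (\<Gamma> j f)))\<^sup>2) =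
    cnj (\<Sum>\<^sub>\<infinity>j\<in>K. hs_inner (\<Gamma> j f) (G j f)) +
      complex_of_real ((norm (\<Sum>\<^sub>\<infinity>j\<in>J - K. hs_adjoint (G j) (\<Gamma> j f)))\<^sup>2)"
proof -
  define s where "s j = hs_adjoint (G j) (\<Gamma> j f)" for j
  define u v where "u = infsum s K" and "v = infsum s (J - K)"
  have G: "bounded_hs_operator (G j)" and \<Gamma>: "bounded_hs_operator (\<Gamma> j)" if "j \<in> J" for j
    using assms that by (auto simp: hs_frame_def alternate_dual_hs_frame_def)
  have J: "(s has_sum f) J"
    using assms(3) by (simp add: alternate_dual_hs_frame_def s_def[abs_def])
  have summable: "s summable_on A" if "A \<subseteq> J" for A
    using summable_on_subset_banach[OF has_sum_imp_summable[OF J] that] .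
  have u: "(s has_sum u) K" and v: "(s has_sum v) (J - K)"
    unfolding u_def v_def using assms(4) by (auto intro!: has_sum_infsum summable)
  have "(s has_sum (u + v)) (K \<union> (J - K))"
    by (rule has_sum_Un_disjoint[OF u v]) auto
  moreover have "K \<union> (J - K) = J"
    using assms(4) by auto
  ultimately have f: "f = u + v"
    using has_sum_unique[OF J] by simp
  \<comment> \<open>Two conjugations: the left side is the conjugate of
    \<open>hs_inner (G j f) (\<Gamma> j f)\<close>, which is \<open>cinner f (s j)\<close>.\<close>
  have inner: "hs_inner (\<Gamma> j f) (G j f) = cinner (s j) f" if "j \<in> J" for j
  proof -
    have "\<Gamma> j f \<in> hilbert_schmidt" "G j f \<in> hilbert_schmidt"
      using G[OF that] \<Gamma>[OF that] by (simp_all add: bounded_hs_operator_def)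
    then show ?thesis
      using hs_adjoint_works[OF G[OF that]] by (metis cinner_commute hs_inner_commute s_def)
  qed
  \<comment> \<open>The continuous linear map \<open>cinner _ f\<close> carries the vector series to
    the scalar one.\<close>
  have inner_sum: "((\<lambda>j. hs_inner (\<Gamma> j f) (G j f)) has_sum cinner x f) A"
    if "(s has_sum x) A" "A \<subseteq> J" for x A
    using has_sum_bounded_linear[OF bounded_linear_cinner_left that(1), of f] that(2)
    by (subst has_sum_cong[where g = "\<lambda>j. cinner (s j) f"]) (auto simp: inner o_def)
  have uf: "((\<lambda>j. hs_inner (\<Gamma> j f) (G j f)) has_sum cinner u f) K"
    and vf: "((\<lambda>j. hs_inner (\<Gamma> j f) (G j f)) has_sum cinner v f) (J - K)"
    using inner_sum[OF u] inner_sum[OF v] assms(4) by auto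
  have "cinner v f + complex_of_real ((norm u)\<^sup>2) = cinner f u + complex_of_real ((norm v)\<^sup>2)"
    by (simp add: f cinner_add_left cinner_add_right cinner_self[symmetric] del: of_real_power)
  \<comment> \<open>Symmetry turns \<open>cinner f u\<close> into the conjugate of the scalar sum
    over \<open>K\<close>.\<close>
  then have "cinner v f + complex_of_real ((norm u)\<^sup>2) =
      cnj (cinner u f) + complex_of_real ((norm v)\<^sup>2)"
    by (simp only: cinner_commute[of f u])
  then show ?thesis
    using has_sum_imp_summable[OF uf] has_sum_imp_summable[OF vf]
      has_sum_imp_summable[OF u] has_sum_imp_summable[OF v]
    unfolding infsumI[OF uf] infsumI[OF vf] u_def v_def s_def[abs_def] by blast
qed

end
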